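(* Let $V$ be a Euclidean vector space of dimension $4$ and let $W$ be an algebraic Weyl operator on $V$. Then $W$ falls into one of the following types: A: $W$ has no eigenflag directions. B: $W$ has at least one eigenflag direction and three different eigenspaces of dimension $2$. In this case, $W$ has exactly four eigenflag directions. C: $W$ has at least one eigenflag direction and two eigenspaces, with dimensions four and two. In this case, the eigenflag directions of $W$ consist of the union of two orthogonal $2$-planes (that is, there are two orthogonal $2$-planes such that a nonzero vector spans an eigenflag direction if and only if it lies in one of them). D: $W$ is null. In this case all directions are eigenflag.
   Context: An algebraic Weyl operator on a Euclidean vector space $V$ is a symmetric operator $W:\Lambda^2V\to\Lambda^2V$ such that the $4$-tensor $W(x,y,z,u)=\langle W(x\wedge y),z\wedge u\rangle$ satisfies the first Bianchi identity $W(x,y,z,u)+W(y,z,x,u)+W(z,x,y,u)=0$ and is totally trace-free: $\sum_i W(x,e_i,y,e_i)=0$ for all $x,y$ and an orthonormal basis $(e_i)$. An eigenflag direction of $W$ is a line $\langle v\rangle$, $0\neq v\in V$, with $W(v\wedge v^\perp)\subset v\wedge v^\perp$, where $v\wedge v^\perp=\{v\wedge w: w\perp v\}$. *)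

theory Defs
  imports "HOL-Analysis.Analysis"
begin

text \<open>
  The second exterior power of a Euclidean space $V$, realised as the space of alternating
  bilinear forms on $V$ (that is, on $V^*$, identified with $V$ through the inner product).
\<close>

typedef (overloaded) 'a bivector =
  "{B :: 'a::euclidean_space \<Rightarrow> 'a \<Rightarrow> real. bilinear B \<and> (\<forall>x. B x x = 0)}"
  morphisms form Abs_bivector
  by (rule exI[of _ "\<lambda>_ _. 0"]) (auto simp: bilinear_def linear_iff)

setup_lifting type_definition_bivector

lemma bivector_eqI: "(\<And>x y. form a x y = form b x y) \<Longrightarrow> a = b"
  by transfer blast

instantiation bivector :: (euclidean_space) real_vector
begin

lift_definition zero_bivector :: "'a bivector" is "\<lambda>_ _. 0"
  by (auto simp: bilinear_def linear_iff)

lift_definition plus_bivector :: "'a bivector \<Rightarrow> 'a bivector \<Rightarrow> 'a bivector"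
  is "\<lambda>a b x y. a x y + b x y"
  by (auto simp: bilinear_def linear_iff algebra_simps)

lift_definition uminus_bivector :: "'a bivector \<Rightarrow> 'a bivector"
  is "\<lambda>a x y. - a x y"
  by (auto simp: bilinear_def linear_iff algebra_simps)

lift_definition minus_bivector :: "'a bivector \<Rightarrow> 'a bivector \<Rightarrow> 'a bivector"
  is "\<lambda>a b x y. a x y - b x y"
  by (auto simp: bilinear_def linear_iff algebra_simps)

lift_definition scaleR_bivector :: "real \<Rightarrow> 'a bivector \<Rightarrow> 'a bivector"
  is "\<lambda>r a x y. r * a x y"
  by (auto simp: bilinear_def linear_iff algebra_simps)

instance
  by standard (transfer; auto simp: fun_eq_iff algebra_simps)+

end

lemma bilinear_form: "bilinear (form a)"
  using form[of a] by auto

lemma form_self [simp]: "form a x x = 0"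
  using form[of a] by auto

lemma form_skew: "form a x y = - form a y x"
  using form_self[of a "x + y"] form_self[of a x] form_self[of a y] bilinear_form[of a]
  by (simp add: bilinear_ladd bilinear_radd del: form_self)

lemma form_expand:
  "form a x y = (\<Sum>b\<in>Basis. \<Sum>c\<in>Basis. (x \<bullet> b) * (y \<bullet> c) * form a b c)"
proof -
  have l: "linear (form a x)" for x
    using bilinear_form[of a] by (simp add: bilinear_def)
  have r: "linear (\<lambda>x. form a x y)" for y
    using bilinear_form[of a] by (simp add: bilinear_def)
  have "form a x y = form a (\<Sum>b\<in>Basis. (x \<bullet> b) *\<^sub>R b) y"
    by (simp add: euclidean_representation)
  also have "\<dots> = (\<Sum>b\<in>Basis. (x \<bullet> b) * form a b y)"
    by (simp add: linear_sum[OF r] linear_scale[OF r])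
  also have "\<dots> = (\<Sum>b\<in>Basis. (x \<bullet> b) * form a b (\<Sum>c\<in>Basis. (y \<bullet> c) *\<^sub>R c))"
    by (simp add: euclidean_representation)
  also have "\<dots> = (\<Sum>b\<in>Basis. (x \<bullet> b) * (\<Sum>c\<in>Basis. (y \<bullet> c) * form a b c))"
    by (simp only: linear_sum[OF l] linear_scale[OF l] real_scaleR_def)
  finally show ?thesis
    by (simp add: sum_distrib_left mult.assoc)
qed

text \<open>
  The factor 1/2 makes the bivectors $e_i \wedge e_j$ with $i < j$ orthonormal; see
  \<open>inner_wedge\<close> below.
\<close>

instantiation bivector :: (euclidean_space) real_inner
begin

definition inner_bivector :: "'a bivector \<Rightarrow> 'a bivector \<Rightarrow> real" where
  "inner_bivector a b = (\<Sum>i\<in>Basis. \<Sum>j\<in>Basis. form a i j * form b i j) / 2"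

definition norm_bivector :: "'a bivector \<Rightarrow> real" where
  "norm_bivector a = sqrt (inner a a)"

definition dist_bivector :: "'a bivector \<Rightarrow> 'a bivector \<Rightarrow> real" where
  "dist_bivector a b = norm (a - b)"

definition sgn_bivector :: "'a bivector \<Rightarrow> 'a bivector" where
  "sgn_bivector a = a /\<^sub>R norm a"

definition uniformity_bivector :: "('a bivector \<times> 'a bivector) filter" where
  "uniformity_bivector = (INF e\<in>{0<..}. principal {(x, y). dist x y < e})"

definition open_bivector :: "'a bivector set \<Rightarrow> bool" where
  "open_bivector S \<longleftrightarrow> (\<forall>x\<in>S. \<forall>\<^sub>F (x', y) in uniformity. x' = x \<longrightarrow> y \<in> S)"

instance
proof
  fix a b c :: "'a bivector" and r :: real
  show "inner a b = inner b a"
    by (simp add: inner_bivector_def mult.commute)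
  show "inner (a + b) c = inner a c + inner b c"
    by (simp add: inner_bivector_def plus_bivector.rep_eq algebra_simps sum.distrib add_divide_distrib)
  show "inner (r *\<^sub>R a) b = r * inner a b"
    by (simp add: inner_bivector_def scaleR_bivector.rep_eq sum_distrib_left mult.assoc)
  show "0 \<le> inner a a"
    by (simp add: inner_bivector_def sum_nonneg)
  show "inner a a = 0 \<longleftrightarrow> a = 0"
  proof
    assume "inner a a = 0"
    then have "\<forall>i\<in>Basis. \<forall>j\<in>Basis. form a i j = 0"
      by (simp add: inner_bivector_def sum_nonneg_eq_0_iff sum_nonneg)
    then show "a = 0"
      by (intro bivector_eqI, subst form_expand) (simp add: zero_bivector.rep_eq)
  next
    assume "a = 0"
    then show "inner a a = 0"
      by (simp add: inner_bivector_def zero_bivector.rep_eq)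
  qed
qed (fact norm_bivector_def dist_bivector_def sgn_bivector_def
       uniformity_bivector_def open_bivector_def)+

end

lift_definition wedge :: "'a::euclidean_space \<Rightarrow> 'a \<Rightarrow> 'a bivector"
  is "\<lambda>x y z u. (x \<bullet> z) * (y \<bullet> u) - (x \<bullet> u) * (y \<bullet> z)"
  by (auto simp: bilinear_def linear_iff inner_add_right algebra_simps)

lemma bilinear_wedge: "bilinear wedge"
  unfolding bilinear_def linear_iff
  by (auto intro!: bivector_eqI
      simp: wedge.rep_eq plus_bivector.rep_eq scaleR_bivector.rep_eq inner_add_left algebra_simps)

lemma wedge_self [simp]: "wedge x x = 0"
  by (rule bivector_eqI) (simp add: wedge.rep_eq zero_bivector.rep_eq)

lemma inner_wedge_right: "inner a (wedge z u) = form a z u"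
proof -
  have 1: "(\<Sum>i\<in>Basis. \<Sum>j\<in>Basis. form a i j * ((z \<bullet> i) * (u \<bullet> j))) = form a z u"
    by (subst form_expand[of a z u]) (simp add: mult_ac)
  have "(\<Sum>i\<in>Basis. \<Sum>j\<in>Basis. form a i j * ((z \<bullet> j) * (u \<bullet> i))) = form a u z"
    by (subst form_expand[of a u z]) (simp add: mult_ac)
  also have "\<dots> = - form a z u"
    using form_skew[of a z u] by simp
  finally show ?thesis
    using 1 by (simp add: inner_bivector_def wedge.rep_eq right_diff_distrib sum_subtractf)
qed

lemma inner_wedge:
  "inner (wedge x y) (wedge z u) = (x \<bullet> z) * (y \<bullet> u) - (x \<bullet> u) * (y \<bullet> z)"
  by (simp add: inner_wedge_right wedge.rep_eq)

lemma form_sum: "form (\<Sum>i\<in>I. f i) x y = (\<Sum>i\<in>I. form (f i) x y)"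
  by (induction I rule: infinite_finite_induct) (simp_all add: zero_bivector.rep_eq plus_bivector.rep_eq)

lemma span_wedge: "span {wedge x y | x y. True} = UNIV"
proof -
  have "a \<in> span {wedge x y | x y. True}" for a :: "'a bivector"
  proof -
    have "a = (\<Sum>i\<in>Basis. \<Sum>j\<in>Basis. (form a i j / 2) *\<^sub>R wedge i j)" (is "_ = ?s")
    proof (rule bivector_eqI)
      fix x y
      have "form ?s x y = inner a (wedge x y)"
        by (simp add: form_sum scaleR_bivector.rep_eq inner_bivector_def wedge.rep_eq
            sum_divide_distrib inner_commute mult.commute)
      then show "form a x y = form ?s x y"
        by (simp add: inner_wedge_right)
    qed
    also have "\<dots> \<in> span {wedge x y | x y. True}"
      by (intro span_sum span_scale span_base) auto
    finally show ?thesis .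
  qed
  then show ?thesis by blast
qed

definition weyl_operator :: "('a::euclidean_space bivector \<Rightarrow> 'a bivector) \<Rightarrow> bool" where
  "weyl_operator W \<longleftrightarrow>
     linear W \<and>
     (\<forall>a b. W a \<bullet> b = a \<bullet> W b) \<and>
     (\<forall>x y z u. W (wedge x y) \<bullet> wedge z u + W (wedge y z) \<bullet> wedge x u
                 + W (wedge z x) \<bullet> wedge y u = 0) \<and>
     (\<forall>x y. (\<Sum>e\<in>Basis. W (wedge x e) \<bullet> wedge y e) = 0)"

text \<open>The set $v \wedge v^\perp$.\<close>

definition flag :: "'a::euclidean_space \<Rightarrow> 'a bivector set" where
  "flag v = wedge v ` {w. orthogonal w v}"

definition eigenflag_directions ::
    "('a::euclidean_space bivector \<Rightarrow> 'a bivector) \<Rightarrow> 'a set set" where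
  "eigenflag_directions W = {span {v} | v. v \<noteq> 0 \<and> W ` flag v \<subseteq> flag v}"

text \<open>
  The eigenspaces are the nonzero spaces $\ker (W - c)$; distinct eigenvalues have distinct
  eigenspaces, so counting eigenspaces amounts to counting eigenvalues.
\<close>

definition eigenspaces :: "('v::real_vector \<Rightarrow> 'v) \<Rightarrow> 'v set set" where
  "eigenspaces W = {{a. W a = c *\<^sub>R a} | c. \<exists>a. a \<noteq> 0 \<and> W a = c *\<^sub>R a}"

definition weyl_type_A :: "('a::euclidean_space bivector \<Rightarrow> 'a bivector) \<Rightarrow> bool" where
  "weyl_type_A W \<longleftrightarrow> eigenflag_directions W = {}"

definition weyl_type_B :: "('a::euclidean_space bivector \<Rightarrow> 'a bivector) \<Rightarrow> bool" where
  "weyl_type_B W \<longleftrightarrow> eigenflag_directions W \<noteq> {} \<and>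
     card (eigenspaces W) = 3 \<and> (\<forall>E\<in>eigenspaces W. dim E = 2)"

definition weyl_type_C :: "('a::euclidean_space bivector \<Rightarrow> 'a bivector) \<Rightarrow> bool" where
  "weyl_type_C W \<longleftrightarrow> eigenflag_directions W \<noteq> {} \<and>
     (\<exists>E F. eigenspaces W = {E, F} \<and> dim E = 4 \<and> dim F = 2)"

definition weyl_type_D :: "('a::euclidean_space bivector \<Rightarrow> 'a bivector) \<Rightarrow> bool" where
  "weyl_type_D W \<longleftrightarrow> (\<forall>a. W a = 0)"

end

theory Submission
  imports Defs
begin

text \<open>
  Let the unit vector $e_0$ span an eigenflag direction. Then $W(e_0 \wedge w) = e_0 \wedge A w$ for a
  symmetric operator $A$ on $e_0^\perp$; diagonalising $A$ gives an orthonormal frame $e_0, \dots, e_3$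
  with $W(e_0 \wedge e_i) = a_i\, e_0 \wedge e_i$. The trace conditions force $a_1 + a_2 + a_3 = 0$ and
  $W(e_j \wedge e_k) = a_i\, e_j \wedge e_k$ for $(i, j, k)$ cyclic, so the type of $W$ is determined by
  the number of distinct values among the $a_i$.

  If $v$ spans an eigenflag direction and $\beta = v \wedge w$, then $\beta$ and $W \beta$ both lie in
  $v \wedge V$, on which the polarised Pluecker form vanishes identically. For the three products
  $p_i = \beta_{0i} \beta_{jk}$ this says $\sum_i p_i = \sum_i a_i p_i = \sum_i a_i^2 p_i = 0$. A value
  $a_i$ different from the other two therefore has $p_i = 0$, for every $w$, which puts $v$ in
  $\langle e_0, e_i \rangle$ or in $\langle e_j, e_k \rangle$.
\<close>

section \<open>Symmetric operators\<close>

text \<open>A maximiser of the quadratic form \<open>q\<close> on the unit sphere of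
  \<open>S\<close> exists by compactness. It is a critical point, so \<open>A x\<close> has no
  component in \<open>S\<close> orthogonal to \<open>x\<close>.\<close>

lemma selfadjoint_eigenvector:
  fixes A :: "'a::euclidean_space \<Rightarrow> 'a"
  assumes A: "linear A" and sym: "\<And>x y. A x \<bullet> y = x \<bullet> A y"
    and S: "subspace S" "A ` S \<subseteq> S" "S \<noteq> {0}"
  obtains x where "x \<in> S" "norm x = 1" "A x = (A x \<bullet> x) *\<^sub>R x"
proof -
  define q where "q x = A x \<bullet> x" for x
  have q_scale: "q (c *\<^sub>R x) = c\<^sup>2 * q x" for c x
    by (simp add: q_def linear_scale[OF A] power2_eq_square)
  have q_add: "q (x + y) = q x + 2 * (A x \<bullet> y) + q y" for x y
    using sym[of y x] by (simp add: q_def linear_add[OF A] inner_add inner_commute)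
  obtain z where z: "z \<in> S" "z \<noteq> 0"
    using S(3) subspace_0[OF S(1)] by blast
  let ?K = "S \<inter> sphere 0 1"
  have "compact ?K"
    by (simp add: S(1) closed_subspace closed_Int_compact)
  moreover have "z /\<^sub>R norm z \<in> ?K"
    using z S(1) by (simp add: subspace_scale)
  then have "?K \<noteq> {}" by blast
  moreover have "continuous_on ?K q"
    unfolding q_def using A by (intro continuous_intros linear_continuous_on linear_linear[THEN iffD2])
  ultimately obtain x where x: "x \<in> ?K" and max: "\<And>y. y \<in> ?K \<Longrightarrow> q y \<le> q x"
    using continuous_attains_sup by metis
  have xx: "x \<bullet> x = 1" using x by (simp add: norm_eq_1)
  \<comment> \<open>Homogeneity of degree two carries the bound from the unit sphere to all of
    \<open>S\<close>.\<close>
  have le: "q y \<le> q x * (y \<bullet> y)" if "y \<in> S" for y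
  proof (cases "y = 0")
    case False
    have "q (y /\<^sub>R norm y) \<le> q x"
      using that False S(1) by (intro max) (simp add: subspace_scale)
    then show ?thesis
      using False by (simp add: q_scale power2_norm_eq_inner[symmetric] field_simps)
  qed (simp add: q_def)
  have crit: "A x \<bullet> y = 0" if y: "y \<in> S" "x \<bullet> y = 0" for y
  proof (rule ccontr)
    define c K k where "c = A x \<bullet> y" and "K = q x * (y \<bullet> y) - q y" and "k = \<bar>K\<bar> + 1"
    assume "A x \<bullet> y \<noteq> 0"
    then have c: "c \<noteq> 0" by (simp add: c_def)
    have k: "k > 0" "K < 2 * k" by (auto simp: k_def)
    \<comment> \<open>Moving from \<open>x\<close> to \<open>x + t *\<^sub>R y\<close> gains
      \<open>2 * t * c\<close> to first order, while maximality allows only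
      \<open>t\<^sup>2 * K\<close>. With \<open>t = c / k\<close> and \<open>2 * k > K\<close> the
      gain wins.\<close>
    define t where "t = c / k"
    have "x + t *\<^sub>R y \<in> S"
      using x y S(1) by (simp add: subspace_add subspace_scale)
    from le[OF this] have "2 * t * c \<le> t\<^sup>2 * K"
      using y xx
      by (simp add: q_add q_scale inner_add inner_commute c_def K_def power2_eq_square algebra_simps)
    then have "c\<^sup>2 * (2 * k) \<le> c\<^sup>2 * K"
      using k by (simp add: t_def power2_eq_square field_simps)
    then show False
      using c k by (simp add: mult_le_cancel_left)
  qed
  \<comment> \<open>The residual \<open>y\<close> lies in \<open>S\<close> and is orthogonal to
    \<open>x\<close>, so \<open>crit\<close> applies to \<open>y\<close> itself and gives
    \<open>y \<bullet> y = 0\<close>.\<close>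
  define y where "y = A x - q x *\<^sub>R x"
  have "y \<in> S"
    using x S by (auto simp: y_def intro!: subspace_diff subspace_scale)
  moreover have "x \<bullet> y = 0"
    using xx by (simp add: y_def q_def inner_diff_right inner_commute)
  ultimately have "y \<bullet> y = 0"
    using crit[of y] by (simp add: y_def inner_diff_left)
  then show thesis
    using that[of x] x by (simp add: y_def q_def)
qed

text \<open>Induction on the dimension: split off one unit eigenvector. By symmetry its orthogonal
  complement in \<open>S\<close> is again invariant.\<close>

lemma selfadjoint_orthonormal_eigenbasis:
  fixes A :: "'a::euclidean_space \<Rightarrow> 'a"
  assumes A: "linear A" and sym: "\<And>x y. A x \<bullet> y = x \<bullet> A y"
    and S: "subspace S" "A ` S \<subseteq> S"
  shows "\<exists>B \<subseteq> S. finite B \<and> card B = dim S \<and> pairwise orthogonal B \<and>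
    (\<forall>x\<in>B. norm x = 1 \<and> A x = (A x \<bullet> x) *\<^sub>R x)"
  using S
proof (induction "dim S" arbitrary: S)
  case 0
  then show ?case by (intro exI[of _ "{}"]) (auto simp: pairwise_def)
next
  case (Suc n)
  have "S \<noteq> {0}" using Suc.hyps(2) by auto
  then obtain x where x: "x \<in> S" "norm x = 1" "A x = (A x \<bullet> x) *\<^sub>R x"
    using selfadjoint_eigenvector[OF A sym Suc.prems] by blast
  define T where "T = {y \<in> S. \<forall>z\<in>span {x}. orthogonal z y}"
  have T: "T = {y \<in> S. x \<bullet> y = 0}"
    by (auto simp: T_def span_singleton orthogonal_def intro: exI[of _ 1] dest: bspec[of _ _ x])
  have "dim T + dim (span {x}) = dim S"
    unfolding T_def using Suc.prems x by (intro dim_subspace_orthogonal_to_vectors)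
      (auto simp: span_minimal)
  moreover have "x \<noteq> 0" using x by auto
  ultimately have n: "n = dim T" using Suc.hyps(2) by simp
  have "subspace T"
    unfolding T using Suc.prems(1)
    by (auto simp: subspace_def inner_add_right)
  moreover have "A ` T \<subseteq> T"
  proof
    fix z assume "z \<in> A ` T"
    then obtain y where y: "y \<in> T" "z = A y" by blast
    have "x \<bullet> A y = (A x \<bullet> x) * (x \<bullet> y)"
      by (metis x(3) sym inner_scaleR_left)
    then show "z \<in> T"
      using y Suc.prems(2) by (auto simp: T)
  qed
  ultimately obtain B where B: "B \<subseteq> T" "finite B" "card B = dim T" "pairwise orthogonal B"
      "\<forall>x\<in>B. norm x = 1 \<and> A x = (A x \<bullet> x) *\<^sub>R x"
    using Suc.hyps(1)[OF n] by blast
  have "x \<notin> B" using B(1) x(2) by (auto simp: T)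
  then have "card (insert x B) = dim S" using B n Suc.hyps(2) by simp
  moreover have "pairwise orthogonal (insert x B)"
    using B(1,4) by (auto simp: T pairwise_insert orthogonal_def inner_commute)
  moreover have "insert x B \<subseteq> S" using B(1) x by (auto simp: T)
  ultimately show ?case
    using B x by (intro exI[of _ "insert x B"]) auto
qed

text \<open>The trace of a bilinear form does not depend on the orthonormal basis. This moves the
  trace condition on a Weyl operator, stated over \<open>Basis\<close>, to an adapted frame.\<close>

lemma sum_Basis_orthonormal:
  fixes g :: "'a::euclidean_space \<Rightarrow> 'a \<Rightarrow> real"
  assumes g: "bilinear g" and B: "finite B" "pairwise orthogonal B" "\<And>x. x \<in> B \<Longrightarrow> norm x = 1"
    "span B = UNIV"
  shows "(\<Sum>b\<in>Basis. g b b) = (\<Sum>x\<in>B. g x x)"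
proof -
  have l: "linear (\<lambda>x. g x y)" and r: "linear (g x)" for x y
    using g by (simp_all add: bilinear_def)
  have "(\<Sum>b\<in>Basis. g b b) = (\<Sum>b\<in>Basis. g (\<Sum>x\<in>B. (b \<bullet> x) *\<^sub>R x) b)"
    using B by (simp add: orthonormal_basis_expand)
  also have "\<dots> = (\<Sum>b\<in>Basis. \<Sum>x\<in>B. (b \<bullet> x) * g x b)"
    by (simp add: linear_sum[OF l] linear_scale[OF l])
  also have "\<dots> = (\<Sum>x\<in>B. \<Sum>b\<in>Basis. (b \<bullet> x) * g x b)"
    by (rule sum.swap)
  also have "\<dots> = (\<Sum>x\<in>B. g x (\<Sum>b\<in>Basis. (x \<bullet> b) *\<^sub>R b))"
    by (simp only: linear_sum[OF r] linear_scale[OF r] real_scaleR_def inner_commute)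
  finally show ?thesis by (simp add: euclidean_representation)
qed

section \<open>Dimensions and the eigenspaces of operators diagonal in an orthonormal basis\<close>

lemma dim_orthonormal_pair:
  fixes x y :: "'a::euclidean_space"
  assumes "x \<bullet> x = 1" "y \<bullet> y = 1" "x \<bullet> y = 0"
  shows "dim (span {x, y}) = 2"
proof -
  have "x \<noteq> y" "x \<noteq> 0" "y \<noteq> 0" using assms by auto
  moreover have "independent {x, y}"
    using assms \<open>x \<noteq> 0\<close> \<open>y \<noteq> 0\<close>
    by (intro pairwise_orthogonal_independent) (auto simp: pairwise_def orthogonal_def inner_commute)
  ultimately show ?thesis
    by (simp add: dim_eq_card_independent)
qed

text \<open>Comparing coefficients along \<open>g\<close> in \<open>W a = c *\<^sub>R a\<close>
  gives \<open>l g * (a \<bullet> g) = c * (a \<bullet> g)\<close>, so only basis vectors with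
  \<open>l g = c\<close> contribute to \<open>a\<close>.\<close>

lemma eigenspace_diagonal:
  fixes W :: "'v::real_inner \<Rightarrow> 'v"
  assumes W: "linear W" and F: "finite F" "pairwise orthogonal F" "\<And>f. f \<in> F \<Longrightarrow> norm f = 1"
    "span F = UNIV" and l: "\<And>f. f \<in> F \<Longrightarrow> W f = l f *\<^sub>R f"
  shows "{a. W a = c *\<^sub>R a} = span {f \<in> F. l f = c}"
proof (intro equalityI subsetI)
  fix a assume "a \<in> {a. W a = c *\<^sub>R a}"
  then have a: "W a = c *\<^sub>R a" by simp
  have exp: "a = (\<Sum>f\<in>F. (a \<bullet> f) *\<^sub>R f)"
    using F by (simp add: orthonormal_basis_expand)
  have "(a \<bullet> g) *\<^sub>R g \<in> span {f \<in> F. l f = c}" if g: "g \<in> F" for g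
  proof (cases "l g = c")
    case True
    then show ?thesis using g by (intro span_scale span_base) simp
  next
    case False
    have "W a = (\<Sum>f\<in>F. (a \<bullet> f * l f) *\<^sub>R f)"
      by (subst exp) (simp add: linear_sum[OF W] linear_scale[OF W] l)
    then have "W a \<bullet> g = (\<Sum>f\<in>F. (a \<bullet> f * l f) * (f \<bullet> g))"
      by (simp add: inner_sum_left)
    also have "\<dots> = (\<Sum>f\<in>F. if f = g then a \<bullet> g * l g else 0)"
      using F g by (intro sum.cong) (auto simp: pairwise_def orthogonal_def norm_eq_1)
    finally have "W a \<bullet> g = l g * (a \<bullet> g)" using F g by simp
    then have "a \<bullet> g = 0" using a False by auto
    then show ?thesis by (simp add: span_zero)
  qed
  then show "a \<in> span {f \<in> F. l f = c}"
    by (subst exp) (rule span_sum)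
next
  fix a assume a: "a \<in> span {f \<in> F. l f = c}"
  have "subspace {a. W a = c *\<^sub>R a}"
    by (auto simp: subspace_def linear_0[OF W] linear_add[OF W] linear_scale[OF W] algebra_simps)
  then have "span {f \<in> F. l f = c} \<subseteq> {a. W a = c *\<^sub>R a}"
    using l by (intro span_minimal) auto
  with a show "a \<in> {a. W a = c *\<^sub>R a}" by blast
qed

lemma dim_eigenspace_diagonal:
  fixes W :: "'v::real_inner \<Rightarrow> 'v"
  assumes W: "linear W" and F: "finite F" "pairwise orthogonal F" "\<And>f. f \<in> F \<Longrightarrow> norm f = 1"
    "span F = UNIV" and l: "\<And>f. f \<in> F \<Longrightarrow> W f = l f *\<^sub>R f"
  shows "dim {a. W a = c *\<^sub>R a} = card {f \<in> F. l f = c}"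
proof -
  have "0 \<notin> F" using F(3) by force
  then have "independent {f \<in> F. l f = c}"
    using F by (intro pairwise_orthogonal_independent) (auto simp: pairwise_def)
  moreover have "span {f \<in> F. l f = c} = span {a. W a = c *\<^sub>R a}"
    by (simp add: eigenspace_diagonal[OF assms] span_span)
  ultimately show ?thesis by (metis dim_eq_card)
qed

text \<open>A value is an eigenvalue exactly when some basis vector carries it. That nonzero vector
  cannot lie in the eigenspace of another value, so eigenspaces are counted by values.\<close>

lemma eigenspaces_diagonal:
  fixes W :: "'v::real_inner \<Rightarrow> 'v"
  assumes W: "linear W" and F: "finite F" "pairwise orthogonal F" "\<And>f. f \<in> F \<Longrightarrow> norm f = 1"
    "span F = UNIV" and l: "\<And>f. f \<in> F \<Longrightarrow> W f = l f *\<^sub>R f"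
  shows "eigenspaces W = (\<lambda>c. {a. W a = c *\<^sub>R a}) ` l ` F"
    and "card (eigenspaces W) = card (l ` F)"
proof -
  have ne: "f \<noteq> 0" if "f \<in> F" for f using F(3)[OF that] by auto
  have "(\<exists>a. a \<noteq> 0 \<and> W a = c *\<^sub>R a) \<longleftrightarrow> c \<in> l ` F" for c
  proof
    assume "\<exists>a. a \<noteq> 0 \<and> W a = c *\<^sub>R a"
    then obtain a where "a \<noteq> 0" "a \<in> span {f \<in> F. l f = c}"
      using eigenspace_diagonal[OF assms, of c] by blast
    then have "{f \<in> F. l f = c} \<noteq> {}" by (metis span_empty singletonD)
    then show "c \<in> l ` F" by blast
  qed (use l ne in blast)
  then show *: "eigenspaces W = (\<lambda>c. {a. W a = c *\<^sub>R a}) ` l ` F"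
    by (auto simp: eigenspaces_def)
  have "inj_on (\<lambda>c. {a. W a = c *\<^sub>R a}) (l ` F)"
  proof (rule inj_onI)
    fix c d assume "c \<in> l ` F" and eq: "{a. W a = c *\<^sub>R a} = {a. W a = d *\<^sub>R a}"
    then obtain f where f: "f \<in> F" "c = l f" by blast
    then have "W f = d *\<^sub>R f" using l eq by blast
    then have "c *\<^sub>R f = d *\<^sub>R f" using l f by metis
    then show "c = d" using ne f by simp
  qed
  then show "card (eigenspaces W) = card (l ` F)"
    unfolding * by (rule card_image)
qed

section \<open>Eigenflag directions\<close>

lemma span_singleton_scale:
  fixes x :: "'v::real_vector"
  assumes "c \<noteq> 0"
  shows "span {c *\<^sub>R x} = span {x}"
proof (intro equalityI span_minimal subspace_span)
  show "{c *\<^sub>R x} \<subseteq> span {x}"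
    by (simp add: span_base span_scale)
  have "(1 / c) *\<^sub>R c *\<^sub>R x \<in> span {c *\<^sub>R x}"
    by (intro span_scale span_base) simp
  then show "{x} \<subseteq> span {c *\<^sub>R x}"
    using assms by simp
qed

lemma wedge_swap: "wedge y x = - wedge x y"
  by (rule bivector_eqI) (simp add: wedge.rep_eq uminus_bivector.rep_eq)

text \<open>Adding a multiple of \<open>v\<close> to \<open>w\<close> does not change
  \<open>wedge v w\<close>, so the orthogonality condition in \<open>flag\<close> costs nothing and
  the flag becomes a linear image.\<close>

lemma flag_eq_range: "flag v = range (wedge v)"
proof (intro equalityI subsetI)
  fix b assume "b \<in> range (wedge v)"
  then obtain w where w: "b = wedge v w" by blast
  \<comment> \<open>For \<open>v = 0\<close> the quotient is 0 by convention and \<open>?u\<close>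
    is \<open>w\<close>, which is still correct.\<close>
  let ?u = "w - ((w \<bullet> v) / (v \<bullet> v)) *\<^sub>R v"
  have "wedge v ?u = b"
    by (simp add: w bilinear_rsub[OF bilinear_wedge] bilinear_rmul[OF bilinear_wedge])
  moreover have "orthogonal ?u v"
    by (simp add: orthogonal_def inner_diff_left)
  ultimately show "b \<in> flag v" by (auto simp: flag_def)
qed (auto simp: flag_def)

text \<open>Another spanning vector of the line is a nonzero multiple of \<open>v\<close>, and the
  scalar can be absorbed into the second factor. Hence the condition can be tested on any spanning
  vector.\<close>

lemma eigenflag_direction_iff:
  assumes "v \<noteq> 0"
  shows "span {v} \<in> eigenflag_directions W \<longleftrightarrow> W ` range (wedge v) \<subseteq> range (wedge v)"
proof
  assume "span {v} \<in> eigenflag_directions W"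
  then obtain u where u: "u \<noteq> 0" "W ` range (wedge u) \<subseteq> range (wedge u)" "span {v} = span {u}"
    by (auto simp: eigenflag_directions_def flag_eq_range)
  from u(3) have "v \<in> span {u}" using span_base[of v "{v}"] by simp
  then obtain c where c: "v = c *\<^sub>R u" by (auto simp: span_singleton)
  then have "c \<noteq> 0" using assms by auto
  have "wedge v w = wedge u (c *\<^sub>R w)" for w
    by (simp add: c bilinear_rmul[OF bilinear_wedge] bilinear_lmul[OF bilinear_wedge])
  moreover have "wedge u w = wedge v (w /\<^sub>R c)" for w
    using \<open>c \<noteq> 0\<close> by (simp add: c bilinear_rmul[OF bilinear_wedge] bilinear_lmul[OF bilinear_wedge])
  ultimately have "range (wedge v) = range (wedge u)" by blast
  then show "W ` range (wedge v) \<subseteq> range (wedge v)" using u by simp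
next
  assume "W ` range (wedge v) \<subseteq> range (wedge v)"
  then show "span {v} \<in> eigenflag_directions W"
    using assms by (auto simp: eigenflag_directions_def flag_eq_range)
qed

text \<open>The Pluecker quadratic form vanishes on decomposable bivectors. The bivectors with
  common factor \<open>v\<close> form a linear space of such, so the polarisation vanishes there
  too.\<close>

lemma polar_pluecker_wedge:
  "form (wedge v w) a b * form (wedge v u) c d + form (wedge v u) a b * form (wedge v w) c d
    + form (wedge v w) a c * form (wedge v u) d b + form (wedge v u) a c * form (wedge v w) d b
    + form (wedge v w) a d * form (wedge v u) b c + form (wedge v u) a d * form (wedge v w) b c = 0"
  by (simp add: wedge.rep_eq algebra_simps)

section \<open>Frames diagonalising a Weyl operator\<close>

locale orthonormal_frame =
  fixes e0 e1 e2 e3 :: "'a::euclidean_space"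
  assumes dim4: "DIM('a) = 4"
    and unit: "e0 \<bullet> e0 = 1" "e1 \<bullet> e1 = 1" "e2 \<bullet> e2 = 1" "e3 \<bullet> e3 = 1"
    and orth: "e0 \<bullet> e1 = 0" "e0 \<bullet> e2 = 0" "e0 \<bullet> e3 = 0" "e1 \<bullet> e2 = 0" "e2 \<bullet> e3 = 0" "e3 \<bullet> e1 = 0"
begin

lemma frame_cyclic: "orthonormal_frame e0 e2 e3 e1"
  using dim4 unit orth by (intro orthonormal_frame.intro) simp_all

lemma orth': "e1 \<bullet> e0 = 0" "e2 \<bullet> e0 = 0" "e3 \<bullet> e0 = 0" "e2 \<bullet> e1 = 0" "e3 \<bullet> e2 = 0" "e1 \<bullet> e3 = 0"
  using orth by (simp_all add: inner_commute)

lemmas frame_inner = unit orth orth'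

lemma frame_nz: "e0 \<noteq> 0" "e1 \<noteq> 0" "e2 \<noteq> 0" "e3 \<noteq> 0"
  using unit by auto

lemma frame_neq: "e0 \<noteq> e1" "e0 \<noteq> e2" "e0 \<noteq> e3" "e1 \<noteq> e2" "e1 \<noteq> e3" "e2 \<noteq> e3"
  using unit orth orth' by auto

lemma span_frame: "span {e0, e1, e2, e3} = UNIV"
proof -
  have "pairwise orthogonal {e0, e1, e2, e3}"
    by (auto simp: pairwise_def orthogonal_def frame_inner)
  then have "independent {e0, e1, e2, e3}"
    using frame_nz by (intro pairwise_orthogonal_independent) auto
  moreover have "card {e0, e1, e2, e3} = DIM('a)"
    using frame_neq by (simp add: dim4)
  ultimately show ?thesis
    by (metis dim_eq_full dim_span_eq_card_independent dim_span span_span)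
qed

lemma frame_orthonormal: "pairwise orthogonal {e0, e1, e2, e3}" "\<And>x. x \<in> {e0, e1, e2, e3} \<Longrightarrow> norm x = 1"
  by (auto simp: pairwise_def orthogonal_def frame_inner norm_eq_1)

lemma frame_expand:
  "v = (v \<bullet> e0) *\<^sub>R e0 + (v \<bullet> e1) *\<^sub>R e1 + (v \<bullet> e2) *\<^sub>R e2 + (v \<bullet> e3) *\<^sub>R e3"
proof -
  have "(\<Sum>i\<in>{e0, e1, e2, e3}. (v \<bullet> i) *\<^sub>R i) = v"
    using span_frame
    by (intro orthonormal_basis_expand)
      (auto simp: pairwise_def orthogonal_def frame_inner norm_eq_1)
  then show ?thesis
    using frame_neq by (simp add: add.assoc)
qed

text \<open>Each plane through \<open>e0\<close> is followed by its orthogonal complement. The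
  cyclic order of \<open>e1\<close>, \<open>e2\<close>, \<open>e3\<close> fixes the signs so that
  rotating these indices permutes the set.\<close>

definition wedges :: "'a bivector set" where
  "wedges = {wedge e0 e1, wedge e2 e3, wedge e0 e2, wedge e3 e1, wedge e0 e3, wedge e1 e2}"

text \<open>Up to sign, the wedge of two frame vectors is zero or in the list. Linearity in each
  argument in turn extends this to all wedges, which span the space.\<close>

lemma wedges_span:
  "span {wedge e0 e1, wedge e2 e3, wedge e0 e2, wedge e3 e1, wedge e0 e3, wedge e1 e2} = UNIV"
    (is "span ?F = _")
proof -
  have e: "wedge x y \<in> span ?F" if "x \<in> {e0, e1, e2, e3}" "y \<in> {e0, e1, e2, e3}" for x y
  proof -
    have "wedge x y = 0 \<or> wedge x y \<in> ?F \<or> - wedge x y \<in> ?F"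
      using that by (auto simp: wedge_swap[symmetric])
    then show ?thesis
      by (metis span_zero span_base span_neg minus_minus)
  qed
  have "wedge x y \<in> span ?F" for x y
  proof -
    have "span {e0, e1, e2, e3} \<subseteq> {y. wedge x y \<in> span ?F}" if "x \<in> {e0, e1, e2, e3}" for x
      using e[OF that] bilinear_wedge
      by (intro span_minimal linear_subspace_vimage[unfolded vimage_def] subspace_span)
        (auto simp: bilinear_def)
    then have "wedge x y \<in> span ?F" if "x \<in> {e0, e1, e2, e3}" for x y
      using that unfolding span_frame by blast
    then have "span {e0, e1, e2, e3} \<subseteq> {x. wedge x y \<in> span ?F}" for y
      using bilinear_wedge
      by (intro span_minimal linear_subspace_vimage[unfolded vimage_def] subspace_span)
        (auto simp: bilinear_def)
    then show ?thesis unfolding span_frame by blast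
  qed
  then have "{wedge x y | x y. True} \<subseteq> span ?F" by blast
  then show ?thesis
    using span_minimal[OF _ subspace_span] span_wedge by blast
qed

lemma wedges_distinct:
  "distinct [wedge e0 e1, wedge e2 e3, wedge e0 e2, wedge e3 e1, wedge e0 e3, wedge e1 e2]"
proof -
  have ne: "a \<noteq> b" if "a \<bullet> b = 0" "a \<bullet> a = 1" for a b :: "'a bivector"
    using that by auto
  show ?thesis
    by (simp, intro conjI ne) (simp_all add: inner_wedge frame_inner)
qed

lemma wedges_orthonormal: "finite wedges" "pairwise orthogonal wedges"
  "\<And>f. f \<in> wedges \<Longrightarrow> norm f = 1" "span wedges = UNIV"
  by (auto simp: wedges_def wedges_span pairwise_def orthogonal_def norm_eq_1 inner_wedge frame_inner)

lemma bivector_eqI_frame: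
  assumes "\<And>f. f \<in> wedges \<Longrightarrow> a \<bullet> f = b \<bullet> f"
  shows "a = b"
proof (rule vector_eq_dot_span)
  show "a \<in> span wedges" "b \<in> span wedges" by (simp_all add: wedges_orthonormal(4))
qed (use assms in \<open>simp add: inner_commute\<close>)

end

section \<open>Normal form of a Weyl operator with an eigenflag direction\<close>

locale weyl_frame = orthonormal_frame e0 e1 e2 e3
  for e0 e1 e2 e3 :: "'a::euclidean_space" +
  fixes W :: "'a bivector \<Rightarrow> 'a bivector" and a1 a2 a3 :: real
  assumes linear_W: "linear W" and sym_W: "W a \<bullet> b = a \<bullet> W b"
    and eigen: "W (wedge e0 e1) = a1 *\<^sub>R wedge e0 e1" "W (wedge e2 e3) = a1 *\<^sub>R wedge e2 e3"
      "W (wedge e0 e2) = a2 *\<^sub>R wedge e0 e2" "W (wedge e3 e1) = a2 *\<^sub>R wedge e3 e1"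
      "W (wedge e0 e3) = a3 *\<^sub>R wedge e0 e3" "W (wedge e1 e2) = a3 *\<^sub>R wedge e1 e2"
    and trace: "a1 + a2 + a3 = 0"
begin

text \<open>Rotating the indices turns a statement that singles out \<open>a1\<close> into the same
  statement for \<open>a2\<close> or \<open>a3\<close>.\<close>

lemma cyclic: "weyl_frame e0 e2 e3 e1 W a2 a3 a1"
  using linear_W sym_W eigen trace
  by (intro weyl_frame.intro frame_cyclic weyl_frame_axioms.intro) (simp_all add: add_ac)

text \<open>Coordinates are inner products with wedges, and by symmetry \<open>W\<close> can be
  moved onto the wedge, where it acts as the scalar \<open>c\<close>.\<close>

lemma form_eigen: "W (wedge x y) = c *\<^sub>R wedge x y \<Longrightarrow> form (W b) x y = c * form b x y"
  by (metis inner_wedge_right sym_W inner_scaleR_right)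

lemma eigenflag_condition:
  assumes v: "W ` range (wedge v) \<subseteq> range (wedge v)" and ne: "a1 \<noteq> a2" "a1 \<noteq> a3"
  shows "v \<bullet> e0 = 0 \<and> v \<bullet> e1 = 0 \<or> v \<bullet> e2 = 0 \<and> v \<bullet> e3 = 0"
proof -
  have *: "form (wedge v w) e0 e1 * form (wedge v w) e2 e3 = 0" for w
  proof -
    define b where "b = wedge v w"
    obtain u where u: "W b = wedge v u" using v unfolding b_def by blast
    define p1 p2 p3 where "p1 = form b e0 e1 * form b e2 e3" and "p2 = form b e0 e2 * form b e3 e1"
      and "p3 = form b e0 e3 * form b e1 e2"
    note W = eigen[THEN form_eigen, of b]
    \<comment> \<open>The three relations are the polarised Pluecker form at the pairs
      \<open>(b, b)\<close>, \<open>(b, W b)\<close> and \<open>(W b, W b)\<close>.\<close>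
    have 1: "p1 + p2 + p3 = 0"
      using polar_pluecker_wedge[of v w e0 e1 w e2 e3]
      by (simp add: b_def[symmetric] p1_def p2_def p3_def)
    have 2: "a1 * p1 + a2 * p2 + a3 * p3 = 0"
      using polar_pluecker_wedge[of v w e0 e1 u e2 e3]
      by (simp add: b_def[symmetric] u[symmetric] W p1_def p2_def p3_def algebra_simps)
    have 3: "a1\<^sup>2 * p1 + a2\<^sup>2 * p2 + a3\<^sup>2 * p3 = 0"
      using polar_pluecker_wedge[of v u e0 e1 u e2 e3]
      by (simp add: b_def[symmetric] u[symmetric] W p1_def p2_def p3_def power2_eq_square algebra_simps)
    \<comment> \<open>Take relation 3 minus \<open>a2 + a3\<close> times relation 2 plus
      \<open>a2 * a3\<close> times relation 1: the coefficient of \<open>p_i\<close> is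
      \<open>(a_i - a2) * (a_i - a3)\<close>.\<close>
    have "(a1 - a2) * (a1 - a3) * p1 = 0"
      using 1 2 3 by algebra
    then show ?thesis using ne by (simp add: p1_def b_def)
  qed
  \<comment> \<open>These four choices of \<open>w\<close> give, up to sign, the products of a
    coordinate of \<open>v\<close> along \<open>e0\<close> or \<open>e1\<close> with one along
    \<open>e2\<close> or \<open>e3\<close>; all of them vanish.\<close>
  show ?thesis
    using *[of "e0 + e2"] *[of "e0 + e3"] *[of "e1 + e2"] *[of "e1 + e3"]
    by (simp add: wedge.rep_eq inner_add_left frame_inner) argo
qed

text \<open>The \<open>x\<close> for which \<open>W (wedge v x)\<close> has factor \<open>v\<close>
  form a subspace, so testing the frame suffices.\<close>

lemma eigenflagI:
  assumes "\<And>x. x \<in> {e0, e1, e2, e3} \<Longrightarrow> \<exists>c. W (wedge v x) = c *\<^sub>R wedge v x"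
  shows "W ` range (wedge v) \<subseteq> range (wedge v)"
proof -
  have "\<exists>u. W (wedge v x) = wedge v u" if "x \<in> {e0, e1, e2, e3}" for x
    using assms[OF that] by (metis bilinear_rmul[OF bilinear_wedge])
  moreover have "subspace {x. \<exists>u. W (wedge v x) = wedge v u}"
    unfolding subspace_def
    by (auto simp: linear_0[OF linear_W] linear_add[OF linear_W] linear_scale[OF linear_W]
        bilinear_rzero[OF bilinear_wedge] bilinear_radd[OF bilinear_wedge] bilinear_rmul[OF bilinear_wedge])
      (metis bilinear_rzero[OF bilinear_wedge] bilinear_radd[OF bilinear_wedge] bilinear_rmul[OF bilinear_wedge])+
  ultimately have "span {e0, e1, e2, e3} \<subseteq> {x. \<exists>u. W (wedge v x) = wedge v u}"
    by (intro span_minimal) auto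
  then show ?thesis unfolding span_frame by blast
qed

lemma eigen': "W (wedge e1 e0) = a1 *\<^sub>R wedge e1 e0" "W (wedge e3 e2) = a1 *\<^sub>R wedge e3 e2"
      "W (wedge e2 e0) = a2 *\<^sub>R wedge e2 e0" "W (wedge e1 e3) = a2 *\<^sub>R wedge e1 e3"
      "W (wedge e3 e0) = a3 *\<^sub>R wedge e3 e0" "W (wedge e2 e1) = a3 *\<^sub>R wedge e2 e1"
  using eigen by (simp_all add: wedge_swap[of e1 e0] wedge_swap[of e3 e2] wedge_swap[of e2 e0]
      wedge_swap[of e1 e3] wedge_swap[of e3 e0] wedge_swap[of e2 e1] linear_neg[OF linear_W])

text \<open>Writing the eigenvalue as \<open>W f \<bullet> f\<close> supplies the eigenvalue
  function on bivectors that the results on diagonal operators expect.\<close>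

lemma wedges_eigen: "f \<in> wedges \<Longrightarrow> W f = (W f \<bullet> f) *\<^sub>R f"
  by (auto simp: wedges_def eigen inner_wedge frame_inner)

lemma image_eigenvalues: "(\<lambda>f. W f \<bullet> f) ` wedges = {a1, a2, a3}"
  by (auto simp: wedges_def eigen inner_wedge frame_inner)

lemmas frame_diagonal = linear_W wedges_orthonormal wedges_eigen

lemma card_eigenspaces: "card (eigenspaces W) = card {a1, a2, a3}"
  using eigenspaces_diagonal(2)[OF frame_diagonal] by (simp add: image_eigenvalues)

lemma eigenspaces_eq: "eigenspaces W = (\<lambda>c. {a. W a = c *\<^sub>R a}) ` {a1, a2, a3}"
  using eigenspaces_diagonal(1)[OF frame_diagonal] by (simp add: image_eigenvalues)

text \<open>Each index carries two of the six frame bivectors, one through \<open>e0\<close> and its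
  complement, so every index with value \<open>c\<close> adds 2.\<close>

lemma dim_eigenspace: "dim {a. W a = c *\<^sub>R a} =
  (if a1 = c then 2 else 0) + (if a2 = c then 2 else 0) + (if a3 = c then 2 else 0)"
proof -
  have "dim {a. W a = c *\<^sub>R a} = card {f \<in> wedges. W f \<bullet> f = c}"
    by (rule dim_eigenspace_diagonal[OF frame_diagonal])
  also have "\<dots> = (\<Sum>f\<in>wedges. if W f \<bullet> f = c then 1 else 0)"
    using wedges_orthonormal(1) by (simp add: sum.If_cases Int_def)
  also have "\<dots> = (if a1 = c then 2 else 0) + (if a2 = c then 2 else 0) + (if a3 = c then 2 else 0)"
    unfolding wedges_def using wedges_distinct
    by (simp add: eigen inner_wedge frame_inner)
  finally show ?thesis .
qed

end

section \<open>The types in terms of the number of distinct values \<open>a1\<close>,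
  \<open>a2\<close>, \<open>a3\<close>\<close>

context weyl_frame
begin

lemma type_B_iff: "weyl_type_B W \<longleftrightarrow> eigenflag_directions W \<noteq> {} \<and> card {a1, a2, a3} = 3"
proof -
  have "dim E = 2" if "card {a1, a2, a3} = 3" "E \<in> eigenspaces W" for E
  proof -
    have "a1 \<noteq> a2" "a1 \<noteq> a3" "a2 \<noteq> a3"
      using that(1) by (auto simp: card_insert_if split: if_splits)
    then show ?thesis
      using that(2) by (auto simp: eigenspaces_eq dim_eigenspace)
  qed
  then show ?thesis
    by (auto simp: weyl_type_B_def card_eigenspaces)
qed

lemma type_C_iff: "weyl_type_C W \<longleftrightarrow> eigenflag_directions W \<noteq> {} \<and> card {a1, a2, a3} = 2"
proof -
  have "card {a1, a2, a3} = 2" if "eigenspaces W = {E, F}" "dim E = 4" "dim F = 2" for E F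
  proof -
    have "E \<noteq> F" using that by auto
    then have "card (eigenspaces W) = 2" using that by simp
    then show ?thesis by (simp add: card_eigenspaces)
  qed
  moreover have "\<exists>E F. eigenspaces W = {E, F} \<and> dim E = 4 \<and> dim F = 2"
    if card: "card {a1, a2, a3} = 2"
  proof -
    let ?E = "\<lambda>c. {a. W a = c *\<^sub>R a}"
    \<comment> \<open>The repeated value has the eigenspace of dimension four, the simple value that
      of dimension two.\<close>
    consider "a1 = a2" "a1 \<noteq> a3" | "a2 = a3" "a1 \<noteq> a2" | "a1 = a3" "a1 \<noteq> a2"
      using card by (cases "a1 = a2"; cases "a2 = a3"; cases "a1 = a3") (auto simp: card_insert_if)
    then show ?thesis
    proof cases
      case 1
      then show ?thesis
        by (intro exI[of _ "?E a1"] exI[of _ "?E a3"])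
          (simp add: eigenspaces_eq dim_eigenspace)
    next
      case 2
      then show ?thesis
        by (intro exI[of _ "?E a2"] exI[of _ "?E a1"])
          (auto simp: eigenspaces_eq dim_eigenspace)
    next
      case 3
      then show ?thesis
        by (intro exI[of _ "?E a1"] exI[of _ "?E a2"])
          (auto simp: eigenspaces_eq dim_eigenspace)
    qed
  qed
  ultimately show ?thesis
    by (auto simp: weyl_type_C_def)
qed

text \<open>Three equal numbers with sum zero are all zero.\<close>

lemma type_D_if_card_1:
  assumes "card {a1, a2, a3} = 1"
  shows "weyl_type_D W"
proof -
  have "a1 = 0" "a2 = 0" "a3 = 0"
    using assms trace by (auto simp: card_insert_if split: if_splits)
  then have "{f \<in> wedges. W f \<bullet> f = 0} = wedges"
    using image_eigenvalues by auto
  then have "{a. W a = 0} = UNIV"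
    using eigenspace_diagonal[OF frame_diagonal, of 0] wedges_orthonormal(4) by simp
  then show ?thesis by (auto simp: weyl_type_D_def)
qed

section \<open>Eigenflag directions of a Weyl operator in normal form\<close>

lemma eigenflag_frame: "x \<in> {e0, e1, e2, e3} \<Longrightarrow> W ` range (wedge x) \<subseteq> range (wedge x)"
  by (rule eigenflagI) (auto simp: eigen eigen' linear_0[OF linear_W])

lemma eigenflag_directions_distinct:
  assumes "card {a1, a2, a3} = 3"
  shows "eigenflag_directions W = (\<lambda>x. span {x}) ` {e0, e1, e2, e3}"
proof (intro equalityI subsetI)
  fix L assume "L \<in> eigenflag_directions W"
  then obtain v where v: "L = span {v}" "v \<noteq> 0"
    by (auto simp: eigenflag_directions_def)
  then have *: "W ` range (wedge v) \<subseteq> range (wedge v)"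
    using \<open>L \<in> eigenflag_directions W\<close> eigenflag_direction_iff by blast
  have ne: "a1 \<noteq> a2" "a1 \<noteq> a3" "a2 \<noteq> a3"
    using assms by (auto simp: card_insert_if split: if_splits)
  interpret c1: weyl_frame e0 e2 e3 e1 W a2 a3 a1 by (rule cyclic)
  interpret c2: weyl_frame e0 e3 e1 e2 W a3 a1 a2 by (rule c1.cyclic)
  \<comment> \<open>Each condition splits the frame into two pairs and kills the coordinates of one
    pair. Any two frame vectors are separated by some splitting, so at most one coordinate
    survives.\<close>
  have "\<exists>x\<in>{e0, e1, e2, e3}. v = (v \<bullet> x) *\<^sub>R x"
    using eigenflag_condition[OF * ne(1,2)] c1.eigenflag_condition[OF * ne(3) ne(1)[symmetric]]
      c2.eigenflag_condition[OF * ne(2,3)[symmetric]] frame_expand[of v]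
    by auto
  then obtain x where x: "x \<in> {e0, e1, e2, e3}" "v = (v \<bullet> x) *\<^sub>R x" by blast
  then have "v \<bullet> x \<noteq> 0" using v(2) by auto
  then have "span {(v \<bullet> x) *\<^sub>R x} = span {x}"
    by (simp add: span_singleton_scale)
  then show "L \<in> (\<lambda>x. span {x}) ` {e0, e1, e2, e3}" using x v by auto
next
  fix L assume "L \<in> (\<lambda>x. span {x}) ` {e0, e1, e2, e3}"
  then obtain x where "L = span {x}" "x \<in> {e0, e1, e2, e3}" by blast
  then show "L \<in> eigenflag_directions W"
    using eigenflag_frame[of x] eigenflag_direction_iff[of x W] frame_nz by blast
qed

lemma card_eigenflag_directions:
  assumes "card {a1, a2, a3} = 3"
  shows "card (eigenflag_directions W) = 4"
proof -
  have "span {x} \<noteq> span {y}" if "x \<bullet> y = 0" "y \<bullet> y = 1" for x y :: 'a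
  proof
    assume "span {x} = span {y}"
    then have "y \<in> span {x}" using span_base[of y "{y}"] by simp
    then show False using that by (auto simp: span_singleton)
  qed
  then show ?thesis
    unfolding eigenflag_directions_distinct[OF assms] by (simp add: frame_inner)
qed

text \<open>For \<open>v\<close> in one plane and a frame vector \<open>z\<close>,
  \<open>wedge v z\<close> has eigenvalue \<open>a1\<close> if \<open>z\<close> lies in the same
  plane. Otherwise it mixes the values \<open>a2\<close> and \<open>a3\<close>, which agree.\<close>

lemma eigenflag_iff_planes:
  assumes "a2 = a3" "a1 \<noteq> a2"
  shows "W ` range (wedge v) \<subseteq> range (wedge v) \<longleftrightarrow> v \<in> span {e0, e1} \<union> span {e2, e3}"
proof
  assume "W ` range (wedge v) \<subseteq> range (wedge v)"
  then have "v \<bullet> e0 = 0 \<and> v \<bullet> e1 = 0 \<or> v \<bullet> e2 = 0 \<and> v \<bullet> e3 = 0"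
    using assms by (intro eigenflag_condition) auto
  then have "v = (v \<bullet> e2) *\<^sub>R e2 + (v \<bullet> e3) *\<^sub>R e3 \<or> v = (v \<bullet> e0) *\<^sub>R e0 + (v \<bullet> e1) *\<^sub>R e1"
    using frame_expand[of v] by auto
  then show "v \<in> span {e0, e1} \<union> span {e2, e3}"
    by (metis UnI1 UnI2 insertI1 insertI2 span_add span_base span_scale)
next
  assume "v \<in> span {e0, e1} \<union> span {e2, e3}"
  then obtain x y where
    "v = x *\<^sub>R e0 + y *\<^sub>R e1 \<or> v = x *\<^sub>R e2 + y *\<^sub>R e3"
    by (auto simp: span_insert span_singleton) (metis add.commute diff_add_cancel)+
  then have "\<exists>c. W (wedge v z) = c *\<^sub>R wedge v z" if "z \<in> {e0, e1, e2, e3}" for z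
  proof (elim disjE)
    assume v: "v = x *\<^sub>R e0 + y *\<^sub>R e1"
    show ?thesis
      by (rule exI[of _ "if z \<in> {e0, e1} then a1 else a2"])
        (use that frame_neq in \<open>auto simp: v bilinear_ladd[OF bilinear_wedge] bilinear_lmul[OF bilinear_wedge]
          linear_add[OF linear_W] linear_scale[OF linear_W] linear_0[OF linear_W] eigen eigen' assms
          scaleR_add_right mult.commute\<close>)
  next
    assume v: "v = x *\<^sub>R e2 + y *\<^sub>R e3"
    show ?thesis
      by (rule exI[of _ "if z \<in> {e2, e3} then a1 else a2"])
        (use that frame_neq in \<open>auto simp: v bilinear_ladd[OF bilinear_wedge] bilinear_lmul[OF bilinear_wedge]
          linear_add[OF linear_W] linear_scale[OF linear_W] linear_0[OF linear_W] eigen eigen' assms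
          scaleR_add_right mult.commute\<close>)
  qed
  then show "W ` range (wedge v) \<subseteq> range (wedge v)" by (rule eigenflagI)
qed

lemma eigenflag_planes_ordered:
  assumes "a2 = a3" "a1 \<noteq> a2"
  shows "\<exists>P Q. subspace P \<and> subspace Q \<and> dim P = 2 \<and> dim Q = 2 \<and>
    (\<forall>p\<in>P. \<forall>q\<in>Q. orthogonal p q) \<and>
    (\<forall>v. v \<noteq> 0 \<longrightarrow> (span {v} \<in> eigenflag_directions W \<longleftrightarrow> v \<in> P \<union> Q))"
proof (intro exI conjI ballI allI)
  fix p q assume "p \<in> span {e0, e1}" "q \<in> span {e2, e3}"
  moreover have "orthogonal x y" if "x \<in> {e0, e1}" "y \<in> {e2, e3}" for x y
    using that by (auto simp: orthogonal_def frame_inner)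
  ultimately show "orthogonal p q"
    by (meson orthogonal_to_span orthogonal_commute)
next
  fix v :: 'a
  show "v \<noteq> 0 \<longrightarrow> (span {v} \<in> eigenflag_directions W \<longleftrightarrow> v \<in> span {e0, e1} \<union> span {e2, e3})"
    using eigenflag_direction_iff[of v W] eigenflag_iff_planes[OF assms, of v] by blast
qed (use dim_orthonormal_pair frame_inner in auto)

text \<open>A cyclic rotation brings the simple value into first place.\<close>

lemma eigenflag_planes:
  assumes "card {a1, a2, a3} = 2"
  shows "\<exists>P Q. subspace P \<and> subspace Q \<and> dim P = 2 \<and> dim Q = 2 \<and>
    (\<forall>p\<in>P. \<forall>q\<in>Q. orthogonal p q) \<and>
    (\<forall>v. v \<noteq> 0 \<longrightarrow> (span {v} \<in> eigenflag_directions W \<longleftrightarrow> v \<in> P \<union> Q))"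
proof -
  interpret c1: weyl_frame e0 e2 e3 e1 W a2 a3 a1 by (rule cyclic)
  interpret c2: weyl_frame e0 e3 e1 e2 W a3 a1 a2 by (rule c1.cyclic)
  consider "a1 = a2" "a3 \<noteq> a1" | "a2 = a3" "a1 \<noteq> a2" | "a3 = a1" "a2 \<noteq> a3"
    using assms by (auto simp: card_insert_if split: if_splits)
  then show ?thesis
    using eigenflag_planes_ordered c1.eigenflag_planes_ordered c2.eigenflag_planes_ordered
    by cases blast+
qed

end

section \<open>Construction of the adapted frame from one eigenflag direction\<close>

lemma weyl_frame_exists:
  fixes W :: "'a::euclidean_space bivector \<Rightarrow> 'a bivector"
  assumes dim: "DIM('a) = 4" and W: "weyl_operator W" and ne: "eigenflag_directions W \<noteq> {}"
  obtains e0 e1 e2 e3 a1 a2 a3 where "weyl_frame e0 e1 e2 e3 W a1 a2 a3"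
proof -
  have lin: "linear W" and sym: "\<And>a b. W a \<bullet> b = a \<bullet> W b"
    and tr: "\<And>x y. (\<Sum>e\<in>Basis. W (wedge x e) \<bullet> wedge y e) = 0"
    using W by (auto simp: weyl_operator_def)
  obtain u where u: "u \<noteq> 0" "span {u} \<in> eigenflag_directions W"
    using ne by (auto simp: eigenflag_directions_def)
  define v where "v = u /\<^sub>R norm u"
  have v: "v \<noteq> 0" "v \<bullet> v = 1" "norm v = 1" "span {v} = span {u}"
    using u(1) by (auto simp: v_def span_singleton_scale power2_norm_eq_inner[symmetric] power2_eq_square)
  have flag: "W ` flag v \<subseteq> flag v"
    using u v eigenflag_direction_iff[of v W] by (simp add: flag_eq_range)
  \<comment> \<open>\<open>A\<close> represents the bilinear form
    \<open>W (wedge v w) \<bullet> wedge v x\<close>, so it is symmetric on the whole space.\<close>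
  define A where "A w = (\<Sum>b\<in>Basis. (W (wedge v w) \<bullet> wedge v b) *\<^sub>R b)" for w
  have blin: "bilinear (\<lambda>x y. W (wedge v x) \<bullet> wedge v y)" for v :: 'a
    unfolding bilinear_def linear_iff
    by (auto simp: bilinear_radd[OF bilinear_wedge] bilinear_rmul[OF bilinear_wedge]
        linear_add[OF lin] linear_scale[OF lin] inner_add)
  have A_inner: "A w \<bullet> x = W (wedge v w) \<bullet> wedge v x" for w x
  proof -
    have l: "linear (\<lambda>y. W (wedge v w) \<bullet> wedge v y)" using blin[of v] by (simp add: bilinear_def)
    have "W (wedge v w) \<bullet> wedge v x = W (wedge v w) \<bullet> wedge v (\<Sum>b\<in>Basis. (x \<bullet> b) *\<^sub>R b)"
      by (simp add: euclidean_representation)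
    also have "\<dots> = (\<Sum>b\<in>Basis. (x \<bullet> b) * (W (wedge v w) \<bullet> wedge v b))"
      by (simp only: linear_sum[OF l] linear_scale[OF l] real_scaleR_def)
    finally show ?thesis
      by (simp add: A_def inner_sum_left inner_commute[of x] mult.commute)
  qed
  have A_lin: "linear A"
    using blin[of v] unfolding bilinear_def linear_iff
    by (auto simp: A_def scaleR_add_left sum.distrib scaleR_sum_right)
  have A_sym: "A x \<bullet> y = x \<bullet> A y" for x y
    by (metis A_inner inner_commute sym)
  define S where "S = {w. v \<bullet> w = 0}"
  \<comment> \<open>The values of \<open>A\<close> are orthogonal to \<open>v\<close> because
    \<open>wedge v v = 0\<close>.\<close>
  have "A ` S \<subseteq> S"
    using A_inner[of _ v] by (auto simp: S_def inner_commute)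
  moreover have "subspace S" "dim S = 3"
    using v(1) dim by (simp_all add: S_def subspace_hyperplane dim_hyperplane)
  ultimately obtain B where B: "B \<subseteq> S" "finite B" "card B = 3" "pairwise orthogonal B"
      "\<forall>x\<in>B. norm x = 1 \<and> A x = (A x \<bullet> x) *\<^sub>R x"
    using selfadjoint_orthonormal_eigenbasis[OF A_lin A_sym] by metis
  obtain e1 e2 e3 where e: "B = {e1, e2, e3}" and neq: "e1 \<noteq> e2" "e2 \<noteq> e3" "e3 \<noteq> e1"
    using B(3) unfolding card_3_iff by metis
  have unit: "v \<bullet> v = 1" "e1 \<bullet> e1 = 1" "e2 \<bullet> e2 = 1" "e3 \<bullet> e3 = 1"
    using B(5) v by (auto simp: e norm_eq_1)
  have orth: "v \<bullet> e1 = 0" "v \<bullet> e2 = 0" "v \<bullet> e3 = 0" "e1 \<bullet> e2 = 0" "e2 \<bullet> e3 = 0" "e3 \<bullet> e1 = 0"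
    using B(1,4) neq by (auto simp: e S_def pairwise_def orthogonal_def)
  then have orth': "e1 \<bullet> v = 0" "e2 \<bullet> v = 0" "e3 \<bullet> v = 0" "e2 \<bullet> e1 = 0" "e3 \<bullet> e2 = 0" "e1 \<bullet> e3 = 0"
    by (simp_all add: inner_commute)
  define a where "a x = A x \<bullet> x" for x
  have eig: "W (wedge v x) = a x *\<^sub>R wedge v x" if "x \<in> B" for x
  proof -
    have "orthogonal x v" using that B(1) by (auto simp: S_def orthogonal_def inner_commute)
    then have "wedge v x \<in> flag v" by (auto simp: flag_def)
    then obtain y where y: "W (wedge v x) = wedge v y" "orthogonal y v"
      using flag by (auto simp: flag_def)
    \<comment> \<open>Since \<open>v\<close> is a unit vector and \<open>y\<close> is orthogonal to
      it, pairing \<open>wedge v y\<close> with \<open>wedge v z\<close> returns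
      \<open>y \<bullet> z\<close>.\<close>
    have "A x \<bullet> z = y \<bullet> z" for z
      using y v by (simp add: A_inner inner_wedge orthogonal_def)
    then have "A x = y" using vector_eq_rdot[of "A x" y] by blast
    then have "y = a x *\<^sub>R x" using B(5) that unfolding a_def by metis
    then show ?thesis using y(1) by (simp only: bilinear_rmul[OF bilinear_wedge])
  qed
  interpret orthonormal_frame v e1 e2 e3
    using dim unit orth by (intro orthonormal_frame.intro)
  have K: "W (wedge x v) \<bullet> wedge y v + W (wedge x e1) \<bullet> wedge y e1
      + W (wedge x e2) \<bullet> wedge y e2 + W (wedge x e3) \<bullet> wedge y e3 = 0" for x y
  proof -
    have "bilinear (\<lambda>z z'. W (wedge x z) \<bullet> wedge y z')"
      unfolding bilinear_def linear_iff
      by (auto simp: bilinear_radd[OF bilinear_wedge] bilinear_rmul[OF bilinear_wedge]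
          linear_add[OF lin] linear_scale[OF lin] inner_add)
    from sum_Basis_orthonormal[OF this _ frame_orthonormal span_frame] tr[of x y]
    show ?thesis using frame_neq by (simp add: add.assoc)
  qed
  define p q r where "p = wedge e2 e3" and "q = wedge e3 e1" and "r = wedge e1 e2"
  have w: "wedge e1 v = - wedge v e1" "wedge e2 v = - wedge v e2" "wedge e3 v = - wedge v e3"
    "wedge e2 e3 = p" "wedge e3 e2 = - p" "wedge e3 e1 = q" "wedge e1 e3 = - q"
    "wedge e1 e2 = r" "wedge e2 e1 = - r"
    by (simp_all add: p_def q_def r_def wedge_swap[symmetric])
  have eig': "W (wedge v e1) = a e1 *\<^sub>R wedge v e1" "W (wedge v e2) = a e2 *\<^sub>R wedge v e2"
    "W (wedge v e3) = a e3 *\<^sub>R wedge v e3"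
    using eig by (simp_all add: e)
  note s = w eig' linear_neg[OF lin] linear_0[OF lin] inner_wedge frame_inner
  have trace: "a e1 + a e2 + a e3 = 0"
    using K[of v v] by (simp add: s)
  \<comment> \<open>With \<open>P\<close>, \<open>Q\<close>, \<open>R\<close> for the three diagonal
    entries, the traces read \<open>a e1 + Q + R = 0\<close> and its cyclic variants. Their sum
    gives \<open>P + Q + R = 0\<close>, hence \<open>P = a e1\<close> and so on.\<close>
  have diag: "W p \<bullet> p = a e1" "W q \<bullet> q = a e2" "W r \<bullet> r = a e3"
    using K[of e1 e1] K[of e2 e2] K[of e3 e3] trace by (simp_all add: s)
  \<comment> \<open>For distinct \<open>x\<close>, \<open>y\<close> among \<open>e1\<close>,
    \<open>e2\<close>, \<open>e3\<close>, only the term of the third vector survives in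
    \<open>K\<close>.\<close>
  have off: "W p \<bullet> q = 0" "W q \<bullet> r = 0" "W r \<bullet> p = 0"
    using K[of e2 e1] K[of e3 e2] K[of e1 e3] by (simp_all add: s)
  then have off': "W q \<bullet> p = 0" "W r \<bullet> q = 0" "W p \<bullet> r = 0"
    by (metis sym inner_commute)+
  have mixed: "W b \<bullet> wedge v x = a x * (b \<bullet> wedge v x)" if "x \<in> B" for b x
    using eig[OF that] by (simp add: sym)
  \<comment> \<open>All six coordinates are compared: \<open>mixed\<close> settles those along
    planes through \<open>v\<close>, the trace identities the other three.\<close>
  have pqr: "W (wedge e2 e3) = a e1 *\<^sub>R wedge e2 e3" "W (wedge e3 e1) = a e2 *\<^sub>R wedge e3 e1"
    "W (wedge e1 e2) = a e3 *\<^sub>R wedge e1 e2"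
    using diag off off'
    by (intro bivector_eqI_frame, unfold wedges_def p_def q_def r_def,
        auto simp: mixed e inner_wedge frame_inner)+
  show thesis
    using lin sym eig' pqr trace orthonormal_frame_axioms
    by (intro that[of v e1 e2 e3 "a e1" "a e2" "a e3"] weyl_frame.intro weyl_frame_axioms.intro) simp_all
qed

theorem lemma1p9:
  fixes W :: "'a::euclidean_space bivector \<Rightarrow> 'a bivector"
  assumes "DIM('a) = 4"
    and "weyl_operator W"
  shows "(weyl_type_A W \<or> weyl_type_B W \<or> weyl_type_C W \<or> weyl_type_D W) \<and>
    (weyl_type_B W \<longrightarrow> card (eigenflag_directions W) = 4) \<and>
    (weyl_type_C W \<longrightarrow>
      (\<exists>P Q. subspace P \<and> subspace Q \<and> dim P = 2 \<and> dim Q = 2 \<and>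
        (\<forall>p\<in>P. \<forall>q\<in>Q. orthogonal p q) \<and>
        (\<forall>v. v \<noteq> 0 \<longrightarrow> (span {v} \<in> eigenflag_directions W \<longleftrightarrow> v \<in> P \<union> Q)))) \<and>
    (weyl_type_D W \<longrightarrow> (\<forall>v. v \<noteq> 0 \<longrightarrow> span {v} \<in> eigenflag_directions W))"
proof -
  have D: "span {v} \<in> eigenflag_directions W" if "weyl_type_D W" "v \<noteq> 0" for v
  proof -
    have "0 \<in> range (wedge v)" by (metis wedge_self rangeI)
    then show ?thesis
      using that by (auto simp: eigenflag_direction_iff weyl_type_D_def)
  qed
  show ?thesis
  proof (cases "eigenflag_directions W = {}")
    case True
    then show ?thesis
      using D by (auto simp: weyl_type_A_def weyl_type_B_def weyl_type_C_def)
  next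
    case False
    obtain e0 e1 e2 e3 a1 a2 a3 where "weyl_frame e0 e1 e2 e3 W a1 a2 a3"
      using weyl_frame_exists[OF assms False] by metis
    then interpret weyl_frame e0 e1 e2 e3 W a1 a2 a3 .
    \<comment> \<open>Three, two or one distinct values lead to types B, C and D
      respectively.\<close>
    have "card {a1, a2, a3} \<in> {1, 2, 3}"
      by (simp add: card_insert_if)
    then show ?thesis
      using D False type_D_if_card_1 card_eigenflag_directions eigenflag_planes
      unfolding type_B_iff type_C_iff by blast
  qed
qed

end
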